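(* Let $R\subset\mathbb{R}^N$ be a (normalized) root system with reflection group $G$, let $k\ge 0$ be a non-negative multiplicity function on $R$, and let $V_k:\Pi\to\Pi$ be the associated Dunkl intertwining operator on the algebra $\Pi$ of complex polynomial functions on $\mathbb{R}^N$. Then $V_k$ is positive on $\Pi$, i.e. if $p\in\Pi$ satisfies $p(x)\ge 0$ for all $x\in\mathbb{R}^N$, then $V_kp(x)\ge 0$ for all $x\in\mathbb{R}^N$.
   Context: A root system is a finite set $R\subset\mathbb{R}^N\setminus\{0\}$ with $R\cap\mathbb{R}\alpha=\{\pm\alpha\}$ and $\sigma_\alpha(R)=R$ for all $\alpha\in R$, where $\sigma_\alpha$ is the reflection in the hyperplane orthogonal to $\alpha$; it is normalized so that $\langle\alpha,\alpha\rangle=2$ for all $\alpha\in R$, where $\langle\cdot,\cdot\rangle$ is the standard Euclidean scalar product. $G$ is the (finite) group generated by $\{\sigma_\alpha:\alpha\in R\}$, and $R_+$ is a fixed positive subsystem ($R=R_+\cup(-R_+)$ disjointly, the two parts separated by a hyperplane through the origin). A multiplicity function is a $G$-invariant function $k:R\to\mathbb{C}$; $k\ge 0$ means $k(\alpha)\ge0$ for all $\alpha$. For $\xi\in\mathbb{R}^N$ the Dunkl operator is $$T_\xi f(x)=\partial_\xi f(x)+\sum_{\alpha\in R_+}k(\alpha)\langle\alpha,\xi\rangle\frac{f(x)-f(\sigma_\alpha x)}{\langle\alpha,x\rangle}.$$ $\Pi=\mathbb{C}[\mathbb{R}^N]=\bigoplus_{n\ge0}\mathcal{P}_n$, with $\mathcal{P}_n$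 the homogeneous polynomials of degree $n$. For $k\ge0$ the intertwining operator $V_k$ is the unique linear isomorphism of $\Pi$ with $V_k(\mathcal{P}_n)=\mathcal{P}_n$ for all $n$, $V_k|_{\mathcal{P}_0}=\mathrm{id}$ and $T_\xi V_k=V_k\partial_\xi$ for all $\xi\in\mathbb{R}^N$. *)

theory Defs
  imports "HOL-Analysis.Analysis" "HOL-Algebra.Bij" "HOL-Algebra.Generated_Groups"
begin

section \<open>Root systems, reflection groups and multiplicity functions\<close>

definition reflection :: "real ^ 'n \<Rightarrow> real ^ 'n \<Rightarrow> real ^ 'n" where
  "reflection \<alpha> x = x - (2 * (\<alpha> \<bullet> x) / (\<alpha> \<bullet> \<alpha>)) *\<^sub>R \<alpha>"

definition root_system :: "(real ^ 'n) set \<Rightarrow> bool" where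
  "root_system R \<longleftrightarrow>
     finite R \<and> 0 \<notin> R \<and>
     (\<forall>\<alpha>\<in>R. R \<inter> {c *\<^sub>R \<alpha> | c. True} = {\<alpha>, - \<alpha>}) \<and>
     (\<forall>\<alpha>\<in>R. reflection \<alpha> ` R = R)"

definition normalized :: "(real ^ 'n) set \<Rightarrow> bool" where
  "normalized R \<longleftrightarrow> (\<forall>\<alpha>\<in>R. \<alpha> \<bullet> \<alpha> = 2)"

text \<open>The group is generated inside the group of all permutations of the space.\<close>

definition reflection_group :: "(real ^ 'n) set \<Rightarrow> (real ^ 'n \<Rightarrow> real ^ 'n) set" where
  "reflection_group R = generate (BijGroup UNIV) (reflection ` R)"

text \<open>The vector \<open>v\<close> is a normal of the separating hyperplane, which is required
  to contain no root; the roots in \<open>uminus ` Rp\<close> then lie strictly on its other side.\<close>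

definition positive_subsystem :: "(real ^ 'n) set \<Rightarrow> (real ^ 'n) set \<Rightarrow> bool" where
  "positive_subsystem R Rp \<longleftrightarrow>
     R = Rp \<union> uminus ` Rp \<and> Rp \<inter> uminus ` Rp = {} \<and>
     (\<exists>v. \<forall>\<alpha>\<in>Rp. v \<bullet> \<alpha> > 0)"

text \<open>Multiplicity functions are total here; their values off \<open>R\<close> are never used.\<close>

definition multiplicity_function :: "(real ^ 'n) set \<Rightarrow> (real ^ 'n \<Rightarrow> complex) \<Rightarrow> bool" where
  "multiplicity_function R k \<longleftrightarrow> (\<forall>g\<in>reflection_group R. \<forall>\<alpha>\<in>R. k (g \<alpha>) = k \<alpha>)"


section \<open>Complex polynomial functions\<close>

text \<open>For complex values, \<^const>\<open>polynomial_function\<close> says that every real-linear functional of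
  \<open>p\<close>, i.e. that the real and the imaginary part of \<open>p\<close>, is a real polynomial function.\<close>

definition polys :: "(real ^ 'n \<Rightarrow> complex) set" where
  "polys = {p. polynomial_function p}"

definition monomial :: "('n \<Rightarrow> nat) \<Rightarrow> real ^ 'n \<Rightarrow> real" where
  "monomial m x = (\<Prod>i\<in>UNIV. (x $ i) ^ m i)"

definition homogeneous_polys :: "nat \<Rightarrow> (real ^ 'n \<Rightarrow> complex) set" where
  "homogeneous_polys n =
     {\<lambda>x. \<Sum>m | (\<Sum>i\<in>UNIV. m i) = n. c m * of_real (monomial m x) | c. True}"

lemma finite_exponents: "finite {m :: 'n::finite \<Rightarrow> nat. (\<Sum>i\<in>UNIV. m i) = n}"
proof (rule finite_subset)
  show "{m :: 'n \<Rightarrow> nat. (\<Sum>i\<in>UNIV. m i) = n} \<subseteq> PiE UNIV (\<lambda>_. {..n})"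
    by (auto simp: member_le_sum)
  show "finite (PiE (UNIV :: 'n set) (\<lambda>_. {..n}))"
    by (intro finite_PiE) auto
qed


section \<open>Dunkl operators and the intertwining operator\<close>

definition partial :: "real ^ 'n \<Rightarrow> (real ^ 'n \<Rightarrow> complex) \<Rightarrow> real ^ 'n \<Rightarrow> complex" where
  "partial \<xi> f x = frechet_derivative f (at x) \<xi>"

text \<open>The singularity of the difference quotient along the hyperplane orthogonal to \<open>\<alpha>\<close> is
  removable for polynomial (indeed for continuously differentiable) \<open>f\<close>; on the hyperplane the
  quotient denotes its continuous extension, not the library's value of a division by zero.\<close>

definition reflection_quotient ::
    "real ^ 'n \<Rightarrow> (real ^ 'n \<Rightarrow> complex) \<Rightarrow> real ^ 'n \<Rightarrow> complex" where
  "reflection_quotient \<alpha> f x =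
     (let q = (\<lambda>y. (f y - f (reflection \<alpha> y)) / of_real (\<alpha> \<bullet> y)) in
      if \<alpha> \<bullet> x \<noteq> 0 then q x else Lim (at x within {y. \<alpha> \<bullet> y \<noteq> 0}) q)"

definition dunkl_operator ::
    "(real ^ 'n) set \<Rightarrow> (real ^ 'n \<Rightarrow> complex) \<Rightarrow> real ^ 'n \<Rightarrow>
     (real ^ 'n \<Rightarrow> complex) \<Rightarrow> real ^ 'n \<Rightarrow> complex" where
  "dunkl_operator Rp k \<xi> f x =
     partial \<xi> f x + (\<Sum>\<alpha>\<in>Rp. k \<alpha> * of_real (\<alpha> \<bullet> \<xi>) * reflection_quotient \<alpha> f x)"

text \<open>The defining properties of the intertwining operator. For \<open>k \<ge> 0\<close> they determine \<open>V\<close> on \<open>polys\<close>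
  (only its values there are constrained).\<close>

definition intertwining_operator ::
    "(real ^ 'n) set \<Rightarrow> (real ^ 'n \<Rightarrow> complex) \<Rightarrow>
     ((real ^ 'n \<Rightarrow> complex) \<Rightarrow> real ^ 'n \<Rightarrow> complex) \<Rightarrow> bool" where
  "intertwining_operator Rp k V \<longleftrightarrow>
     bij_betw V polys polys \<and>
     (\<forall>p\<in>polys. \<forall>q\<in>polys. V (\<lambda>x. p x + q x) = (\<lambda>x. V p x + V q x)) \<and>
     (\<forall>c. \<forall>p\<in>polys. V (\<lambda>x. c * p x) = (\<lambda>x. c * V p x)) \<and>
     (\<forall>n. V ` homogeneous_polys n = homogeneous_polys n) \<and>
     (\<forall>p\<in>homogeneous_polys 0. V p = p) \<and>
     (\<forall>\<xi>. \<forall>p\<in>polys. dunkl_operator Rp k \<xi> (V p) = V (partial \<xi> p))"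

end

theory Submission
  imports Defs
begin

text \<open>
  For \<open>p \<in> \<Pi>\<close> put \<open>F x y = V (\<lambda>z. p (z + y)) x\<close>. A derivative of \<open>p (z + y)\<close> in \<open>z\<close> is also its derivative
  in \<open>y\<close>, so the intertwining relation says that the Dunkl operator \<open>T\<^sub>\<xi>\<close> in \<open>x\<close> acts on \<open>F\<close> as \<open>\<partial>\<^sub>\<xi>\<close> in
  \<open>y\<close>. With the choice \<open>\<xi> = x\<close> the denominators of the Dunkl operator cancel and the relation becomes
  \[ (x \cdot \nabla_y - x \cdot \nabla_x) F (x, y)
     = \sum_{\alpha \in R_+} k(\alpha) (F (x, y) - F (\sigma_\alpha x, y)). \]
  This says that \<open>F\<close> is harmonic for a Markov process: \<open>y\<close> moves with velocity \<open>x\<close> while \<open>x\<close> contracts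
  radially to \<open>0\<close> and jumps to \<open>\<sigma>\<^sub>\<alpha> x\<close> at rate \<open>k \<alpha> \<ge> 0\<close>. On \<open>x = 0\<close>, where the process ends,
  \<open>F 0 y = p y\<close>, because \<open>V\<close> preserves the degree and fixes the constants. Nonnegativity of \<open>p\<close>
  therefore spreads to all of \<open>F\<close>, in particular to \<open>F x 0 = V p x\<close>.

  The spreading is a minimum principle (\<open>transport_jump_minimum_principle\<close>): the sets
  \<open>{(x, y). norm x + norm y \<le> r}\<close> are compact and invariant under both the jumps and the flow, and
  at a minimum of \<open>F\<close> all jump terms have the same sign. The equation itself is
  \<open>radial_derivative_intertwining\<close>, the values at \<open>x = 0\<close> are \<open>intertwining_at_0\<close>, and the regularity
  of \<open>F\<close> comes from a finite expansion of \<open>p (z + y)\<close> into products of polynomials in \<open>z\<close> and in \<open>y\<close>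
  (\<open>polys_translate_split\<close>), to which \<open>V\<close> applies term by term. Since \<open>V p\<close> is complex-valued,
  everything is composed with a real functional, and the real and imaginary parts are treated
  separately.
\<close>

section \<open>A minimum principle for transport with jumps\<close>

text \<open>
  At a minimum with \<open>x \<noteq> 0\<close> the sum over the jumps is nonpositive, so moving along the flow
  \<open>(x - h x, y + h x)\<close> does not increase \<open>u\<close> to first order. The additional term \<open>e * norm x\<close> turns this
  into a strict decrease, so that the perturbed function can have its minimum only at \<open>x = 0\<close>.
\<close>

lemma transport_jump_minimum_principle:
  fixes u :: "'a::euclidean_space \<Rightarrow> 'a \<Rightarrow> real"
  assumes cont: "continuous_on UNIV (\<lambda>(x, y). u x y)"
    and c: "\<And>i. i \<in> A \<Longrightarrow> c i \<ge> 0"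
    and s: "\<And>i x. i \<in> A \<Longrightarrow> norm (s i x) = norm x"
    and deriv: "\<And>x y. ((\<lambda>h. u (x - h *\<^sub>R x) (y + h *\<^sub>R x)) has_real_derivative
                  (\<Sum>i\<in>A. c i * (u x y - u (s i x) y))) (at 0)"
    and init: "\<And>y. u 0 y \<ge> 0"
  shows "u x0 y0 \<ge> 0"
proof -
  \<comment> \<open>\<open>norm x + norm y\<close> does not increase along the flow: the norm that \<open>x\<close> loses bounds what \<open>y\<close> gains.\<close>
  define C :: "('a \<times> 'a) set" where "C = {(x, y). norm x + norm y \<le> norm x0 + norm y0}"
  have perturbed: "u x0 y0 + e * norm x0 \<ge> 0" if e: "e > 0" for e
  proof -
    define w where "w = (\<lambda>z. u (fst z) (snd z) + e * norm (fst z))"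
    have "closed C"
      unfolding C_def case_prod_unfold by (intro closed_Collect_le continuous_intros)
    moreover have "bounded C"
    proof (rule boundedI)
      fix z assume "z \<in> C"
      then show "norm z \<le> norm x0 + norm y0"
        using norm_Pair_le[of "fst z" "snd z"] by (auto simp: C_def)
    qed
    ultimately have "compact C" by (simp add: compact_eq_bounded_closed)
    moreover have "(x0, y0) \<in> C" by (simp add: C_def)
    moreover have "continuous_on C w"
      unfolding w_def using continuous_on_subset[OF cont subset_UNIV, of C]
      by (intro continuous_intros) (simp add: case_prod_unfold)
    ultimately obtain z where z: "z \<in> C" and min: "\<And>z'. z' \<in> C \<Longrightarrow> w z \<le> w z'"
      using continuous_attains_inf[of C w] by blast
    obtain x y where zxy: "z = (x, y)" by (cases z)
    have "x = 0"
    proof (rule ccontr)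
      assume x: "x \<noteq> 0"
      have jumps: "u x y \<le> u (s i x) y" if "i \<in> A" for i
      proof -
        have "(s i x, y) \<in> C" using z that by (simp add: C_def zxy s)
        from min[OF this] show ?thesis by (simp add: w_def zxy s that)
      qed
      define D where "D = (\<Sum>i\<in>A. c i * (u x y - u (s i x) y)) - e * norm x"
      have "D < 0"
      proof -
        have "(\<Sum>i\<in>A. c i * (u x y - u (s i x) y)) \<le> 0"
          using c jumps by (intro sum_nonpos mult_nonneg_nonpos) auto
        moreover have "e * norm x > 0" using e x by simp
        ultimately show ?thesis by (simp add: D_def)
      qed
      define g where "g h = u (x - h *\<^sub>R x) (y + h *\<^sub>R x) + e * ((1 - h) * norm x)" for h
      have "(g has_real_derivative D) (at 0)"
      proof -
        have "((\<lambda>h. e * ((1 - h) * norm x)) has_real_derivative - (e * norm x)) (at 0)"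
          by (auto intro!: derivative_eq_intros)
        from DERIV_add[OF deriv[of x y] this] show ?thesis by (simp add: D_def g_def[abs_def])
      qed
      from DERIV_neg_dec_right[OF this \<open>D < 0\<close>]
      obtain d where d: "d > 0" and dec: "\<And>h. 0 < h \<Longrightarrow> h < d \<Longrightarrow> g h < g 0"
        by auto
      \<comment> \<open>With \<open>h \<le> 1\<close> the first component has not yet passed through the origin.\<close>
      define h where "h = min (d / 2) 1"
      have h: "0 < h" "h < d" "h \<le> 1" using d by (auto simp: h_def)
      have nx: "norm (x - h *\<^sub>R x) = (1 - h) * norm x"
      proof -
        have "x - h *\<^sub>R x = (1 - h) *\<^sub>R x" by (simp add: algebra_simps)
        then show ?thesis using h by simp
      qed
      have "norm (y + h *\<^sub>R x) \<le> norm y + h * norm x"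
        using norm_triangle_ineq[of y "h *\<^sub>R x"] h by simp
      then have "(x - h *\<^sub>R x, y + h *\<^sub>R x) \<in> C"
        using z by (auto simp: C_def zxy nx algebra_simps)
      from min[OF this] dec[OF h(1,2)] show False
        by (simp add: w_def zxy nx g_def)
    qed
    then have "w z \<ge> 0" using init by (simp add: w_def zxy)
    then show ?thesis using min[OF \<open>(x0, y0) \<in> C\<close>] by (simp add: w_def)
  qed
  show ?thesis
  proof (rule ccontr)
    assume neg: "\<not> u x0 y0 \<ge> 0"
    define c where "c = norm x0 + 1"
    have c: "c > 0" by (simp add: c_def add_nonneg_pos)
    define e where "e = - u x0 y0 / (2 * c)"
    have e: "e > 0" using neg c by (simp add: e_def divide_neg_pos)
    have "e * norm x0 \<le> e * c" using e by (simp add: c_def)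
    also have "\<dots> = - u x0 y0 / 2"
      using c by (simp add: e_def)
    finally show False using perturbed[OF e] neg by simp
  qed
qed

section \<open>Expansion of translated polynomials\<close>

text \<open>
  Sums and products of expansions are naturally indexed by disjoint unions and Cartesian products;
  re-indexing by an initial segment of the natural numbers lets the existence statements below
  quantify over a single index type.
\<close>

lemma sum_nat_enumeration:
  fixes I :: "'i set"
  assumes "finite I"
  shows "\<exists>n e. \<forall>g :: 'i \<Rightarrow> 'b::comm_monoid_add. (\<Sum>i\<in>I. g i) = (\<Sum>j<n::nat. g (e j))"
proof -
  obtain e where "bij_betw e {..<card I} I"
    using ex_bij_betw_nat_finite[OF assms] by (auto simp: atLeast0LessThan)
  then have "(\<Sum>i\<in>I. g i) = (\<Sum>j<card I. g (e j))" for g :: "'i \<Rightarrow> 'b"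
    by (rule sum.reindex_bij_betw[symmetric])
  then show ?thesis by blast
qed

lemma real_polynomial_translate_split:
  fixes q :: "'a::euclidean_space \<Rightarrow> real"
  assumes "real_polynomial_function q"
  shows "\<exists>(n::nat) a b. (\<forall>j. real_polynomial_function (a j)) \<and> (\<forall>j. real_polynomial_function (b j)) \<and>
           (\<forall>z y. q (z + y) = (\<Sum>j<n. b j y * a j z))"
  using assms
proof induction
  case (linear f)
  interpret f: bounded_linear f by fact
  have "f (z + y) = (\<Sum>j<2::nat. (if j = 0 then 1 else f y) * (if j = 0 then f z else 1))" for z y
    by (simp add: f.add numeral_2_eq_2)
  moreover have f: "real_polynomial_function f"
    using linear by (rule real_polynomial_function.intros(1))
  have one: "real_polynomial_function (\<lambda>_ :: 'a. 1)"
    by (rule real_polynomial_function.intros(2))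
  have "real_polynomial_function (\<lambda>z. if j = 0 then f z else 1)"
      "real_polynomial_function (\<lambda>y. if j = 0 then 1 else f y)" for j :: nat
    by (cases "j = 0"; simp add: f one)+
  ultimately show ?case
    by (intro exI[of _ 2] exI[of _ "\<lambda>j z. if j = 0 then f z else 1"]
        exI[of _ "\<lambda>j y. if j = 0 then 1 else f y"]) auto
next
  case (const c)
  show ?case
    by (intro exI[of _ 1] exI[of _ "\<lambda>_ _. c"] exI[of _ "\<lambda>_ _. 1"])
       (auto intro: real_polynomial_function.intros)
next
  case (add f g)
  obtain n a b where 1: "\<forall>j. real_polynomial_function (a j)" "\<forall>j. real_polynomial_function (b j)"
      "\<forall>z y. f (z + y) = (\<Sum>j<n::nat. b j y * a j z)"
    using add.IH(1) by blast
  obtain m a' b' where 2: "\<forall>j. real_polynomial_function (a' j)" "\<forall>j. real_polynomial_function (b' j)"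
      "\<forall>z y. g (z + y) = (\<Sum>j<m::nat. b' j y * a' j z)"
    using add.IH(2) by blast
  have fin: "finite ({..<n} <+> {..<m})" by simp
  obtain l e where e: "\<forall>h :: nat + nat \<Rightarrow> real. (\<Sum>i\<in>{..<n} <+> {..<m}. h i) = (\<Sum>j<l::nat. h (e j))"
    using sum_nat_enumeration[OF fin] by (elim exE) (rule that)
  have "f (z + y) + g (z + y) = (\<Sum>j<l. case_sum b b' (e j) y * case_sum a a' (e j) z)" for z y
    using 1(3) 2(3) e[rule_format, of "\<lambda>i. case_sum b b' i y * case_sum a a' i z", symmetric]
    by (simp add: sum.Plus)
  moreover have "real_polynomial_function (case_sum a a' (e j))"
      "real_polynomial_function (case_sum b b' (e j))" for j
    using 1(1,2) 2(1,2) by (auto split: sum.split)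
  ultimately show ?case
    by (intro exI[of _ l] exI[of _ "\<lambda>j. case_sum a a' (e j)"] exI[of _ "\<lambda>j. case_sum b b' (e j)"]) auto
next
  case (mult f g)
  obtain n a b where 1: "\<forall>j. real_polynomial_function (a j)" "\<forall>j. real_polynomial_function (b j)"
      "\<forall>z y. f (z + y) = (\<Sum>j<n::nat. b j y * a j z)"
    using mult.IH(1) by blast
  obtain m a' b' where 2: "\<forall>j. real_polynomial_function (a' j)" "\<forall>j. real_polynomial_function (b' j)"
      "\<forall>z y. g (z + y) = (\<Sum>j<m::nat. b' j y * a' j z)"
    using mult.IH(2) by blast
  have fin: "finite ({..<n} \<times> {..<m})" by simp
  obtain l e where e: "\<forall>h :: nat \<times> nat \<Rightarrow> real. (\<Sum>i\<in>{..<n} \<times> {..<m}. h i) = (\<Sum>j<l::nat. h (e j))"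
    using sum_nat_enumeration[OF fin] by (elim exE) (rule that)
  have "f (z + y) * g (z + y) = (\<Sum>j<l. (b (fst (e j)) y * b' (snd (e j)) y) *
      (a (fst (e j)) z * a' (snd (e j)) z))" for z y
  proof -
    have "f (z + y) * g (z + y) = (\<Sum>i<n. \<Sum>j<m. (b i y * a i z) * (b' j y * a' j z))"
      by (simp only: 1(3) 2(3) sum_product)
    also have "\<dots> = (\<Sum>i\<in>{..<n} \<times> {..<m}. (b (fst i) y * b' (snd i) y) * (a (fst i) z * a' (snd i) z))"
      by (simp add: sum.cartesian_product case_prod_unfold mult_ac)
    also have "\<dots> = (\<Sum>j<l. (b (fst (e j)) y * b' (snd (e j)) y) *
        (a (fst (e j)) z * a' (snd (e j)) z))"
      by (rule e[rule_format])
    finally show ?thesis .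
  qed
  moreover have "real_polynomial_function (\<lambda>z. a (fst (e j)) z * a' (snd (e j)) z)"
      "real_polynomial_function (\<lambda>y. b (fst (e j)) y * b' (snd (e j)) y)" for j
    using 1(1,2) 2(1,2) by (auto intro: real_polynomial_function.intros)
  ultimately show ?case
    by (intro exI[of _ l] exI[of _ "\<lambda>j z. a (fst (e j)) z * a' (snd (e j)) z"]
        exI[of _ "\<lambda>j y. b (fst (e j)) y * b' (snd (e j)) y"]) auto
qed

section \<open>Complex polynomial functions\<close>

lemma polys_Re_Im:
  "f \<in> polys \<longleftrightarrow> real_polynomial_function (\<lambda>x. Re (f x)) \<and> real_polynomial_function (\<lambda>x. Im (f x))"
  (is "_ \<longleftrightarrow> ?R")
proof
  assume "f \<in> polys"
  then have "real_polynomial_function (g \<circ> f)" if "bounded_linear g" for g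
    using that by (auto simp: polys_def polynomial_function_def)
  from this[OF bounded_linear_Re] this[OF bounded_linear_Im] show ?R by (simp add: o_def)
next
  assume R: ?R
  have "polynomial_function (\<lambda>x. Re (f x) *\<^sub>R 1 + Im (f x) *\<^sub>R \<i>)"
    using R by (intro polynomial_function_add polynomial_function_mult polynomial_function_const)
      (auto simp: real_polynomial_function_eq)
  moreover have "f = (\<lambda>x. Re (f x) *\<^sub>R 1 + Im (f x) *\<^sub>R \<i>)"
    by (auto simp: complex_eq_iff)
  ultimately show "f \<in> polys" by (simp add: polys_def)
qed

lemma polys_of_real: "real_polynomial_function q \<Longrightarrow> (\<lambda>x. complex_of_real (q x)) \<in> polys"
  by (auto simp: polys_Re_Im intro: real_polynomial_function.intros)

lemma polys_const: "(\<lambda>x. c) \<in> polys"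
  by (auto simp: polys_Re_Im intro: real_polynomial_function.intros)

lemma polys_add: "f \<in> polys \<Longrightarrow> g \<in> polys \<Longrightarrow> (\<lambda>x. f x + g x) \<in> polys"
  by (auto simp: polys_Re_Im intro: real_polynomial_function.intros)

lemma polys_cmult: "f \<in> polys \<Longrightarrow> (\<lambda>x. c * f x) \<in> polys"
  by (auto simp: polys_Re_Im intro!: real_polynomial_function.intros(2-4) real_polynomial_function_diff)

lemma polys_sum: "(\<And>i. i \<in> I \<Longrightarrow> f i \<in> polys) \<Longrightarrow> (\<lambda>x. \<Sum>i\<in>I. f i x) \<in> polys"
  by (induction I rule: infinite_finite_induct) (auto intro: polys_const polys_add)

lemma polys_translate_split:
  fixes p :: "real ^ 'n \<Rightarrow> complex"
  assumes "p \<in> polys"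
  shows "\<exists>(n::nat) a b. (\<forall>j. a j \<in> polys) \<and> (\<forall>j. real_polynomial_function (b j)) \<and>
           (\<forall>z y. p (z + y) = (\<Sum>j<n. of_real (b j y) * a j z))"
proof -
  have re: "real_polynomial_function (\<lambda>x. Re (p x))" and im: "real_polynomial_function (\<lambda>x. Im (p x))"
    using assms by (auto simp: polys_Re_Im)
  obtain n a b where 1: "\<forall>j. real_polynomial_function (a j)" "\<forall>j. real_polynomial_function (b j)"
      "\<forall>z y. Re (p (z + y)) = (\<Sum>j<n::nat. b j y * a j z)"
    using real_polynomial_translate_split[OF re] by blast
  obtain m a' b' where 2: "\<forall>j. real_polynomial_function (a' j)" "\<forall>j. real_polynomial_function (b' j)"
      "\<forall>z y. Im (p (z + y)) = (\<Sum>j<m::nat. b' j y * a' j z)"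
    using real_polynomial_translate_split[OF im] by blast
  have fin: "finite ({..<n} <+> {..<m})" by simp
  obtain l e where e: "\<forall>h :: nat + nat \<Rightarrow> complex. (\<Sum>i\<in>{..<n} <+> {..<m}. h i) = (\<Sum>j<l::nat. h (e j))"
    using sum_nat_enumeration[OF fin] by (elim exE) (rule that)
  define A where "A = case_sum (\<lambda>j z. complex_of_real (a j z)) (\<lambda>j z. \<i> * complex_of_real (a' j z))"
  show ?thesis
  proof (intro exI[of _ l] exI[of _ "\<lambda>j. A (e j)"] exI[of _ "\<lambda>j. case_sum b b' (e j)"] conjI allI)
    fix j
    show "A (e j) \<in> polys"
      using 1(1) 2(1) by (cases "e j") (simp_all add: A_def polys_of_real polys_cmult)
    show "real_polynomial_function (case_sum b b' (e j))"
      using 1(2) 2(2) by (auto split: sum.split)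
  next
    fix z y
    have "p (z + y) = of_real (Re (p (z + y))) + \<i> * of_real (Im (p (z + y)))"
      by (rule complex_eq)
    also have "\<dots> = (\<Sum>i\<in>{..<n} <+> {..<m}. of_real (case_sum b b' i y) * A i z)"
      using 1(3) 2(3) by (simp add: sum.Plus A_def sum_distrib_left mult_ac)
    finally show "p (z + y) = (\<Sum>j<l. of_real (case_sum b b' (e j) y) * A (e j) z)"
      by (rule trans) (rule e[rule_format])
  qed
qed

section \<open>Homogeneous components\<close>

inductive_set monomial_span :: "(real ^ 'n \<Rightarrow> complex) set" where
  monomial: "(\<lambda>x. c * of_real (monomial m x)) \<in> monomial_span"
| add: "f \<in> monomial_span \<Longrightarrow> g \<in> monomial_span \<Longrightarrow> (\<lambda>x. f x + g x) \<in> monomial_span"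

lemma monomial_span_cmult: "f \<in> monomial_span \<Longrightarrow> (\<lambda>x. c * f x) \<in> monomial_span"
proof (induction rule: monomial_span.induct)
  case (monomial d m)
  then show ?case using monomial_span.monomial[of "c * d" m] by (simp add: mult.assoc)
next
  case (add f g)
  then show ?case using monomial_span.add by (fastforce simp: distrib_left)
qed

lemma monomial_span_sum:
  "(\<And>i. i \<in> I \<Longrightarrow> f i \<in> monomial_span) \<Longrightarrow> (\<lambda>x. \<Sum>i\<in>I. f i x) \<in> monomial_span"
proof (induction I rule: infinite_finite_induct)
  case (insert i I)
  then show ?case by (auto intro: monomial_span.add)
qed (use monomial_span.monomial[of 0] in auto)

lemma monomial_Suc: "monomial (m(i := Suc (m i))) x = x $ i * monomial m x"
proof -
  have "monomial (m(i := Suc (m i))) x = (\<Prod>j\<in>UNIV. (if j = i then x $ i else 1) * (x $ j) ^ m j)"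
    unfolding monomial_def by (rule prod.cong) auto
  then show ?thesis by (simp add: prod.distrib monomial_def)
qed

lemma monomial_span_coordinate:
  "f \<in> monomial_span \<Longrightarrow> (\<lambda>x. of_real (x $ i) * f x) \<in> monomial_span"
proof (induction rule: monomial_span.induct)
  case (monomial c m)
  then show ?case
    using monomial_span.monomial[of c "m(i := Suc (m i))"] by (simp add: monomial_Suc mult_ac)
next
  case (add f g)
  then show ?case using monomial_span.add by (fastforce simp: distrib_left)
qed

text \<open>
  The induction goes through because \<open>f\<close> is arbitrary: the span is then a module over the real
  polynomial functions, and multiplication by a product is two successive multiplications.
\<close>

lemma monomial_span_mult:
  fixes q :: "real ^ 'n \<Rightarrow> real"
  assumes "real_polynomial_function q"
  shows "f \<in> monomial_span \<Longrightarrow> (\<lambda>x. of_real (q x) * f x) \<in> monomial_span"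
  using assms
proof (induction arbitrary: f)
  case (linear q)
  interpret q: bounded_linear q by fact
  have q: "q x = (\<Sum>i\<in>UNIV. (x $ i) * q (axis i 1))" for x
  proof -
    have "q x = q (\<Sum>i\<in>UNIV. (x $ i) *\<^sub>R axis i 1)"
      using basis_expansion[of x] by (simp add: scalar_mult_eq_scaleR)
    then show ?thesis by (simp add: q.sum q.scaleR)
  qed
  have "of_real (q x) * f x = (\<Sum>i\<in>UNIV. of_real (q (axis i 1)) * (of_real (x $ i) * f x))" for x
    by (simp add: q[of x] sum_distrib_left sum_distrib_right mult_ac)
  then have eq: "(\<lambda>x. of_real (q x) * f x) =
      (\<lambda>x. \<Sum>i\<in>UNIV. of_real (q (axis i 1)) * (of_real (x $ i) * f x))"
    by (rule ext)
  show ?case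
    unfolding eq
    by (intro monomial_span_sum monomial_span_cmult monomial_span_coordinate linear.prems)
next
  case (const c)
  then show ?case by (simp add: monomial_span_cmult)
next
  case (add q r)
  then show ?case using monomial_span.add by (fastforce simp: distrib_right)
next
  case (mult q r)
  then show ?case by (simp add: mult.assoc)
qed

lemma polys_subset_monomial_span: "polys \<subseteq> monomial_span"
proof
  fix f :: "real ^ 'n \<Rightarrow> complex" assume f: "f \<in> polys"
  have one: "(\<lambda>x. 1) \<in> monomial_span"
    using monomial_span.monomial[of 1 "\<lambda>_. 0"] by (simp add: monomial_def)
  have "(\<lambda>x. of_real (Re (f x)) * 1 + \<i> * (of_real (Im (f x)) * 1)) \<in> monomial_span"
    using f by (intro monomial_span.add monomial_span_cmult monomial_span_mult one)
      (auto simp: polys_Re_Im)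
  then show "f \<in> monomial_span" by (simp flip: complex_eq)
qed

lemma monomial_span_subset_polys: "monomial_span \<subseteq> polys"
proof
  fix f :: "real ^ 'n \<Rightarrow> complex" assume "f \<in> monomial_span"
  then show "f \<in> polys"
  proof induction
    case (monomial c m)
    have "real_polynomial_function (\<lambda>x. monomial m x)"
      unfolding monomial_def
      by (intro real_polynomial_function_prod real_polynomial_function_power
          real_polynomial_function.intros(1) bounded_linear_vec_nth) auto
    then show ?case by (intro polys_cmult polys_of_real)
  next
    case (add f g)
    then show ?case by (intro polys_add)
  qed
qed

lemma monomial_homogeneous:
  "(\<lambda>x. c * of_real (monomial m x)) \<in> homogeneous_polys (\<Sum>i\<in>UNIV. m i)"
proof -
  let ?M = "{m'. (\<Sum>i\<in>UNIV. m' i) = (\<Sum>i\<in>UNIV. m i)}"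
  have "(\<Sum>m'\<in>?M. (if m' = m then c else 0) * of_real (monomial m' x)) =
      (\<Sum>m'\<in>?M. if m' = m then c * of_real (monomial m x) else 0)" for x
    by (rule sum.cong) auto
  then have eq: "(\<lambda>x. c * of_real (monomial m x)) =
      (\<lambda>x. \<Sum>m'\<in>?M. (if m' = m then c else 0) * of_real (monomial m' x))"
    by (simp add: sum.delta[OF finite_exponents])
  show ?thesis
    unfolding homogeneous_polys_def
    by (intro CollectI exI[of _ "\<lambda>m'. if m' = m then c else 0"] conjI TrueI eq)
qed

lemma homogeneous_at_0:
  fixes f :: "real ^ 'n \<Rightarrow> complex"
  assumes "f \<in> homogeneous_polys n" "n > 0"
  shows "f 0 = 0"
proof -
  have "monomial m 0 = 0" if "(\<Sum>i\<in>UNIV. m i) = n" for m :: "'n::finite \<Rightarrow> nat"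
  proof -
    have "\<exists>i. m i \<noteq> 0" by (rule ccontr) (use \<open>n > 0\<close> that in simp)
    then show ?thesis by (auto simp: monomial_def)
  qed
  moreover obtain c where "f = (\<lambda>x. \<Sum>m | (\<Sum>i\<in>UNIV. m i) = n. c m * of_real (monomial m x))"
    using assms(1) unfolding homogeneous_polys_def by blast
  ultimately show ?thesis by simp
qed

section \<open>The intertwining operator\<close>

context
  fixes Rp :: "(real ^ 'n) set" and k V
  assumes V: "intertwining_operator Rp k V"
begin

lemma intertwining_polys: "f \<in> polys \<Longrightarrow> V f \<in> polys"
  using V by (auto simp: intertwining_operator_def bij_betw_def)

lemma intertwining_add: "f \<in> polys \<Longrightarrow> g \<in> polys \<Longrightarrow> V (\<lambda>x. f x + g x) = (\<lambda>x. V f x + V g x)"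
  using V by (auto simp: intertwining_operator_def)

lemma intertwining_cmult: "f \<in> polys \<Longrightarrow> V (\<lambda>x. c * f x) = (\<lambda>x. c * V f x)"
  using V by (auto simp: intertwining_operator_def)

lemma intertwining_sum:
  assumes "\<And>i. i \<in> I \<Longrightarrow> f i \<in> polys"
  shows "V (\<lambda>x. \<Sum>i\<in>I. c i * f i x) = (\<lambda>x. \<Sum>i\<in>I. c i * V (f i) x)"
  using assms
proof (induction I rule: infinite_finite_induct)
  case (insert i I)
  have "V (\<lambda>x. c i * f i x + (\<Sum>j\<in>I. c j * f j x)) =
      (\<lambda>x. V (\<lambda>x. c i * f i x) x + V (\<lambda>x. \<Sum>j\<in>I. c j * f j x) x)"
    using insert by (intro intertwining_add polys_cmult polys_sum) auto
  then show ?case using insert by (simp add: intertwining_cmult)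
qed (use intertwining_cmult[OF polys_const, of 0] in auto)

text \<open>
  Degree preservation is what counts: on monomials of positive degree both sides vanish, and on
  constants \<open>V\<close> is the identity.
\<close>

lemma intertwining_at_0: "f \<in> polys \<Longrightarrow> V f 0 = f 0"
proof -
  assume "f \<in> polys"
  then have "f \<in> monomial_span" using polys_subset_monomial_span by blast
  then show ?thesis
  proof induction
    case (monomial c m)
    let ?f = "\<lambda>x. c * complex_of_real (monomial m x)" and ?n = "\<Sum>i\<in>UNIV. m i"
    have f: "?f \<in> homogeneous_polys ?n" by (rule monomial_homogeneous)
    show ?case
    proof (cases "?n = 0")
      case True
      then have "V ?f = ?f"
        using f V unfolding intertwining_operator_def by metis
      then show ?thesis by simp
    next
      case False
      then have n: "?n > 0" by blast
      have "V ?f \<in> homogeneous_polys ?n" using f V unfolding intertwining_operator_def by blast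
      then show ?thesis
        using homogeneous_at_0[OF f n] homogeneous_at_0[of "V ?f", OF _ n] by metis
    qed
  next
    case (add f g)
    then show ?case using monomial_span_subset_polys by (subst intertwining_add) auto
  qed
qed

text \<open>
  In the direction \<open>\<xi> = x\<close> the factor \<open>\<langle>\<alpha>, \<xi>\<rangle>\<close> cancels the denominator \<open>\<langle>\<alpha>, x\<rangle>\<close>. On the hyperplane
  \<open>\<langle>\<alpha>, x\<rangle> = 0\<close> both sides of the cancellation are \<open>0\<close>, since \<open>x\<close> is fixed by the reflection.
\<close>

lemma radial_derivative_intertwining:
  assumes "f \<in> polys"
  shows "partial x (V f) x = V (partial x f) x - (\<Sum>\<alpha>\<in>Rp. k \<alpha> * (V f x - V f (reflection \<alpha> x)))"
proof -
  have q: "of_real (\<alpha> \<bullet> x) * reflection_quotient \<alpha> (V f) x = V f x - V f (reflection \<alpha> x)" for \<alpha>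
    by (cases "\<alpha> \<bullet> x = 0") (auto simp: reflection_quotient_def reflection_def)
  have "V (partial x f) x = dunkl_operator Rp k x (V f) x"
    using V assms by (auto simp: intertwining_operator_def)
  then show ?thesis by (simp add: dunkl_operator_def mult.assoc q)
qed

end

section \<open>Positivity\<close>

lemma norm_reflection: "norm (reflection \<alpha> x) = norm x"
proof (cases "\<alpha> = 0")
  case False
  then have "reflection \<alpha> x \<bullet> reflection \<alpha> x = x \<bullet> x"
    by (simp add: reflection_def inner_diff_left inner_diff_right inner_commute field_simps)
  then show ?thesis by (simp add: norm_eq_sqrt_inner)
qed (simp add: reflection_def)

lemma polys_has_derivative:
  "f \<in> polys \<Longrightarrow> (f has_derivative frechet_derivative f (at x)) (at x)"
  unfolding polys_def
  by (simp add: differentiable_at_polynomial_function flip: frechet_derivative_works)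

text \<open>
  A real-linear functional commutes with the real coefficients \<open>k \<alpha>\<close>, so its composition with \<open>F\<close>
  satisfies the same transport equation and the minimum principle applies. Taking \<open>L\<close> to be the
  real part and plus or minus the imaginary part covers complex values.
\<close>

lemma intertwining_functional_nonneg:
  fixes Rp :: "(real ^ 'n) set"
  assumes V: "intertwining_operator Rp k V"
    and k: "\<And>\<alpha>. \<alpha> \<in> Rp \<Longrightarrow> k \<alpha> \<in> \<real>\<^sub>\<ge>\<^sub>0"
    and p: "p \<in> polys" and L: "bounded_linear L" and pos: "\<And>x. L (p x) \<ge> (0::real)"
  shows "L (V p x) \<ge> 0"
proof -
  interpret L: bounded_linear L by fact
  obtain n :: nat and a b where "\<forall>j. a j \<in> polys" "\<forall>j. real_polynomial_function (b j)"
      "\<forall>z y. p (z + y) = (\<Sum>j<n. of_real (b j y) * a j z)"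
    using polys_translate_split[OF p] by blast
  then have a: "\<And>j. a j \<in> polys" and b: "\<And>j. real_polynomial_function (b j)"
    and split: "\<And>z y. p (z + y) = (\<Sum>j<n. of_real (b j y) * a j z)"
    by auto
  define shift where "shift y = (\<lambda>z. p (z + y))" for y
  define F where "F x y = V (shift y) x" for x y
  have shift_eq: "shift y = (\<lambda>z. \<Sum>j<n. of_real (b j y) * a j z)" for y
    by (simp add: shift_def split)
  have shift: "shift y \<in> polys" for y
    unfolding shift_eq by (intro polys_sum polys_cmult a)
  have F_eq: "F x y = (\<Sum>j<n. of_real (b j y) * V (a j) x)" for x y
    unfolding F_def shift_eq by (subst intertwining_sum[OF V a]) simp
  define b' where "b' j y = frechet_derivative (b j) (at y)" for j y
  have db: "(b j has_derivative b' j y) (at y)" for j y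
    using b unfolding b'_def
    by (simp add: differentiable_at_polynomial_function real_polynomial_function_eq
        flip: frechet_derivative_works)
  have partial_shift: "partial \<xi> (shift y) = (\<lambda>z. \<Sum>j<n. of_real (b' j y \<xi>) * a j z)" for \<xi> y
  proof
    fix z
    \<comment> \<open>Both derivatives of \<open>p (z + y)\<close>, in \<open>z\<close> and in \<open>y\<close>, are the derivative of \<open>p\<close> at \<open>z + y\<close>.\<close>
    have dp: "(p has_derivative frechet_derivative p (at (z + y))) (at (z + y))"
      using p by (rule polys_has_derivative)
    have "(shift y has_derivative frechet_derivative p (at (z + y))) (at z)"
      unfolding shift_def
      by (rule has_derivative_compose[where f = "\<lambda>z. z + y" and g = p, OF _ dp])
        (auto intro!: derivative_eq_intros)
    then have 1: "partial \<xi> (shift y) z = frechet_derivative p (at (z + y)) \<xi>"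
      unfolding partial_def by (simp only: frechet_derivative_at[symmetric])
    have 2: "((\<lambda>y. p (z + y)) has_derivative frechet_derivative p (at (z + y))) (at y)"
      by (rule has_derivative_compose[where f = "\<lambda>y. z + y" and g = p, OF _ dp])
        (auto intro!: derivative_eq_intros)
    have 3: "((\<lambda>y. p (z + y)) has_derivative (\<lambda>\<xi>. \<Sum>j<n. of_real (b' j y \<xi>) * a j z)) (at y)"
      unfolding split by (auto intro!: derivative_eq_intros db)
    show "partial \<xi> (shift y) z = (\<Sum>j<n. of_real (b' j y \<xi>) * a j z)"
      unfolding 1 using has_derivative_unique[OF 2 3] by metis
  qed
  \<comment> \<open>The left-hand side differentiates in \<open>z\<close>, the right-hand side differentiates the expansion of \<open>F x y\<close> in \<open>y\<close>.\<close>
  have V_partial_shift: "V (partial \<xi> (shift y)) x = (\<Sum>j<n. of_real (b' j y \<xi>) * V (a j) x)" for \<xi> x y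
    unfolding partial_shift by (subst intertwining_sum[OF V a]) simp
  have kR: "k \<alpha> = of_real (Re (k \<alpha>))" "Re (k \<alpha>) \<ge> 0" if "\<alpha> \<in> Rp" for \<alpha>
    using k[OF that] by (auto simp: nonneg_Reals_def)
  have Va: "(V (a j) has_derivative frechet_derivative (V (a j)) (at x)) (at x)" for j x
    by (rule polys_has_derivative[OF intertwining_polys[OF V a]])
  have partial_F: "partial \<xi> (V (shift y)) x =
      (\<Sum>j<n. of_real (b j y) * frechet_derivative (V (a j)) (at x) \<xi>)" for \<xi> x y
  proof -
    have eq: "V (shift y) = (\<lambda>x. \<Sum>j<n. of_real (b j y) * V (a j) x)"
      by (rule ext) (use F_eq in \<open>simp add: F_def\<close>)
    have d: "((\<lambda>x. \<Sum>j<n. of_real (b j y) * V (a j) x) has_derivative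
        (\<lambda>\<xi>. \<Sum>j<n. of_real (b j y) * frechet_derivative (V (a j)) (at x) \<xi>)) (at x)"
      by (auto intro!: derivative_eq_intros Va)
    show ?thesis unfolding partial_def eq frechet_derivative_at[OF d, symmetric] by (rule refl)
  qed
  have transport: "((\<lambda>h. F (x - h *\<^sub>R x) (y + h *\<^sub>R x)) has_vector_derivative
      (\<Sum>\<alpha>\<in>Rp. k \<alpha> * (F x y - F (reflection \<alpha> x) y))) (at 0)" for x y
  proof -
    have dx: "((\<lambda>h. V (a j) (x - h *\<^sub>R x)) has_derivative
        (\<lambda>h. frechet_derivative (V (a j)) (at x) (- (h *\<^sub>R x)))) (at 0)" for j
      by (rule has_derivative_compose[where g = "V (a j)" and f = "\<lambda>h. x - h *\<^sub>R x"])
        (auto intro!: derivative_eq_intros Va)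
    have dy: "((\<lambda>h. b j (y + h *\<^sub>R x)) has_derivative (\<lambda>h. b' j y (h *\<^sub>R x))) (at 0)" for j
      by (rule has_derivative_compose[where g = "b j" and f = "\<lambda>h. y + h *\<^sub>R x"])
        (auto intro!: derivative_eq_intros db)
    have lin: "frechet_derivative (V (a j)) (at x) (- (h *\<^sub>R x)) =
        - (h *\<^sub>R frechet_derivative (V (a j)) (at x) x)"
      "b' j y (h *\<^sub>R x) = h * b' j y x" for j h
      using has_derivative_linear[OF Va[of j x]] has_derivative_linear[OF db[of j y]]
      by (simp_all add: linear_neg linear_cmul)
    have collect: "(\<Sum>j<n. of_real (b j y) * frechet_derivative (V (a j)) (at x) (- (h *\<^sub>R x)) +
          of_real (b' j y (h *\<^sub>R x)) * V (a j) x) =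
        h *\<^sub>R ((\<Sum>j<n. of_real (b' j y x) * V (a j) x) -
          (\<Sum>j<n. of_real (b j y) * frechet_derivative (V (a j)) (at x) x))" for h
      unfolding lin sum_subtractf[symmetric] scaleR_sum_right
      by (rule sum.cong) (simp_all add: scaleR_conv_of_real algebra_simps)
    have "((\<lambda>h. F (x - h *\<^sub>R x) (y + h *\<^sub>R x)) has_derivative
        (\<lambda>h. h *\<^sub>R (V (partial x (shift y)) x - partial x (V (shift y)) x))) (at 0)"
      unfolding F_eq V_partial_shift partial_F
      by (rule has_derivative_eq_rhs[OF has_derivative_sum[OF has_derivative_mult[OF
            has_derivative_of_real[OF dy] dx]]])
        (simp add: collect)
    then show ?thesis
      unfolding radial_derivative_intertwining[OF V shift] has_vector_derivative_def
      by (simp add: F_def)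
  qed
  have "L (F x 0) \<ge> 0"
  proof (rule transport_jump_minimum_principle[where u = "\<lambda>x y. L (F x y)" and A = Rp
        and c = "\<lambda>\<alpha>. Re (k \<alpha>)" and s = reflection])
    have "continuous_on UNIV (b j)" "continuous_on UNIV (V (a j))" for j
      using b intertwining_polys[OF V a]
      by (auto simp: polys_def real_polynomial_function_eq intro: continuous_on_polymonial_function)
    then have "continuous_on UNIV (\<lambda>z. F (fst z) (snd z))"
      unfolding F_eq
      by (auto intro!: continuous_intros continuous_on_compose2[where f = fst] continuous_on_compose2[where f = snd])
    then show "continuous_on UNIV (\<lambda>(x, y). L (F x y))"
      unfolding case_prod_unfold by (rule L.continuous_on)
  next
    fix x y
    have "L (\<Sum>\<alpha>\<in>Rp. k \<alpha> * (F x y - F (reflection \<alpha> x) y)) =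
        (\<Sum>\<alpha>\<in>Rp. Re (k \<alpha>) * (L (F x y) - L (F (reflection \<alpha> x) y)))"
      unfolding L.sum
    proof (rule sum.cong)
      fix \<alpha> assume "\<alpha> \<in> Rp"
      then have "k \<alpha> * (F x y - F (reflection \<alpha> x) y) = Re (k \<alpha>) *\<^sub>R (F x y - F (reflection \<alpha> x) y)"
        using kR(1) by (metis scaleR_conv_of_real)
      then show "L (k \<alpha> * (F x y - F (reflection \<alpha> x) y)) =
          Re (k \<alpha>) * (L (F x y) - L (F (reflection \<alpha> x) y))"
        by (simp add: L.scaleR L.diff)
    qed simp
    then show "((\<lambda>h. L (F (x - h *\<^sub>R x) (y + h *\<^sub>R x))) has_real_derivative
        (\<Sum>\<alpha>\<in>Rp. Re (k \<alpha>) * (L (F x y) - L (F (reflection \<alpha> x) y)))) (at 0)"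
      using L.has_vector_derivative[OF transport[of x y]]
      by (simp add: has_real_derivative_iff_has_vector_derivative)
  next
    show "L (F 0 y) \<ge> 0" for y
      using intertwining_at_0[OF V shift] pos by (simp add: F_def shift_def)
  qed (use kR(2) norm_reflection in auto)
  then show ?thesis by (simp add: F_def shift_def)
qed

theorem theorem4p1:
  fixes R Rp :: "(real ^ 'n) set"
    and k :: "real ^ 'n \<Rightarrow> complex"
    and V :: "(real ^ 'n \<Rightarrow> complex) \<Rightarrow> real ^ 'n \<Rightarrow> complex"
  assumes "root_system R" and "normalized R"
    and "positive_subsystem R Rp"
    and "multiplicity_function R k" and "\<forall>\<alpha>\<in>R. k \<alpha> \<in> \<real>\<^sub>\<ge>\<^sub>0"
    and "intertwining_operator Rp k V"
  shows "\<forall>p\<in>polys. (\<forall>x. p x \<in> \<real>\<^sub>\<ge>\<^sub>0) \<longrightarrow> (\<forall>x. V p x \<in> \<real>\<^sub>\<ge>\<^sub>0)"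
proof (intro ballI impI allI)
  fix p :: "real ^ 'n \<Rightarrow> complex" and x
  assume p: "p \<in> polys" "\<forall>x. p x \<in> \<real>\<^sub>\<ge>\<^sub>0"
  have "Rp \<subseteq> R"
    using assms(3) by (auto simp: positive_subsystem_def)
  then have k: "\<And>\<alpha>. \<alpha> \<in> Rp \<Longrightarrow> k \<alpha> \<in> \<real>\<^sub>\<ge>\<^sub>0"
    using assms(5) by auto
  have L: "L (V p x) \<ge> 0" if "bounded_linear L" "\<And>x. L (p x) \<ge> 0" for L :: "complex \<Rightarrow> real"
    by (rule intertwining_functional_nonneg[OF assms(6)]) (use k p(1) that in auto)
  have "Re (p x) \<ge> 0" "Im (p x) = 0" for x
    using p(2) by (auto simp: complex_nonneg_Reals_iff)
  \<comment> \<open>The imaginary part of \<open>p\<close> is \<open>0\<close>, hence nonnegative with either sign.\<close>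
  then have "Re (V p x) \<ge> 0" "Im (V p x) \<ge> 0" "- Im (V p x) \<ge> 0"
    using L[OF bounded_linear_Re] L[OF bounded_linear_Im] L[OF bounded_linear_minus[OF bounded_linear_Im]]
    by auto
  then show "V p x \<in> \<real>\<^sub>\<ge>\<^sub>0" by (simp add: complex_nonneg_Reals_iff)
qed

end
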